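(* The generalized sun graph $G=C_{6,1}(0,6,6,12,6,6)$ on $42$ vertices is integral, with $$\sigma(G)=\bigl\{0^{[32]},\ \pm2^{[2]},\ \pm3^{[2]},\ \pm4\bigr\}.$$ In particular, $G$ is an integral generalized sun graph which is not a cycle, whereas its unique cycle has order $6$. Consequently, the assertion "if a generalized sun graph that is not a cycle is integral, then the order of its cycle is a multiple of $4$" is false.
   Context: A graph is integral if all eigenvalues of its adjacency matrix are integers; $\sigma(G)$ denotes the spectrum of the adjacency matrix, and $x^{[r]}$ means that the eigenvalue $x$ has multiplicity $r$ (so $\pm x^{[r]}$ means that each of $x$ and $-x$ has multiplicity $r$; no superscript means multiplicity $1$). $P_t$ denotes the path on $t$ vertices. Attaching $P_t$ to a vertex $v$ means adding $t$ new vertices $u_1,\dots,u_t$ with the edges $vu_1$ and $u_iu_{i+1}$, $1\leq i\leq t-1$. A generalized sun graph is a graph obtained from a cycle by attaching paths to vertices of the cycle. For nonnegative integers $n_1,\dots,n_b$, $C_{b,1}(n_1,\dots,n_b)$ is the graph obtained from the cycle $C_b=v_1v_2\cdots v_bv_1$ by attaching $n_k$ pendant vertices (copies of $P_1$) to $v_k$ for $1\leq k\leq b$. *)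

theory Defs
  imports
    Complex_Main
    "Jordan_Normal_Form.Char_Poly"
    "Graph_Theory.Pair_Digraph"
    "Graph_Theory.Digraph_Component"
begin

text \<open>
  A finite simple graph is a \<^locale>\<open>pair_graph\<close>: a finite, loop-free, symmetric
  digraph without parallel arcs, each undirected edge being represented by its two arcs.
\<close>

definition adjacency_matrix_wrt :: "'a list \<Rightarrow> 'a pair_pre_digraph \<Rightarrow> complex mat" where
  "adjacency_matrix_wrt xs G =
     mat (length xs) (length xs) (\<lambda>(i, j). if (xs ! i, xs ! j) \<in> parcs G then 1 else 0)"

text \<open>
  The adjacency matrix depends on the choice of an ordering of the vertices; its
  characteristic polynomial, and hence the spectrum, does not: see
  \<open>char_poly_adjacency_matrix\<close> below. The entries are regarded as complex numbers, so
  no eigenvalue is lost.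
\<close>

definition adjacency_matrix :: "'a pair_pre_digraph \<Rightarrow> complex mat" where
  "adjacency_matrix G = adjacency_matrix_wrt (SOME xs. distinct xs \<and> set xs = pverts G) G"

text \<open>
  Multiplicities are algebraic; the matrix being real symmetric for a simple graph, they
  are also the geometric ones.
\<close>

definition graph_spectrum :: "'a pair_pre_digraph \<Rightarrow> complex multiset" where
  "graph_spectrum G = proots (char_poly (adjacency_matrix G))"

definition integral_graph :: "'a pair_pre_digraph \<Rightarrow> bool" where
  "integral_graph G \<longleftrightarrow>
     pair_graph G \<and> (\<forall>x. eigenvalue (adjacency_matrix G) x \<longrightarrow> x \<in> \<int>)"

text \<open>The cycle \<open>v\<^sub>1 v\<^sub>2 \<dots> v\<^sub>b v\<^sub>1\<close> on the list \<open>[v\<^sub>1, \<dots>, v\<^sub>b]\<close>.\<close>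

definition cycle_graph :: "'a list \<Rightarrow> 'a pair_pre_digraph" where
  "cycle_graph vs =
     \<lparr> pverts = set vs,
       parcs = set (zip vs (rotate1 vs)) \<union> (set (zip vs (rotate1 vs)))\<inverse> \<rparr>"

definition is_cycle_graph :: "'a pair_pre_digraph \<Rightarrow> bool" where
  "is_cycle_graph C \<longleftrightarrow> (\<exists>vs. distinct vs \<and> 3 \<le> length vs \<and> C = cycle_graph vs)"

definition cycle_in :: "'a pair_pre_digraph \<Rightarrow> 'a pair_pre_digraph \<Rightarrow> bool" where
  "cycle_in C G \<longleftrightarrow> is_cycle_graph C \<and> subgraph (with_proj C) (with_proj G)"

text \<open>
  Attaching to \<open>v\<close> the path on the list \<open>us = [u\<^sub>1, \<dots>, u\<^sub>t]\<close> of new vertices: since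
  \<^const>\<open>zip\<close> truncates, \<open>zip (v # us) us\<close> is
  \<open>[(v, u\<^sub>1), (u\<^sub>1, u\<^sub>2), \<dots>]\<close>, ending with the last edge of the path.
\<close>

definition attach_path ::
    "'a \<Rightarrow> 'a list \<Rightarrow> 'a pair_pre_digraph \<Rightarrow> 'a pair_pre_digraph" where
  "attach_path v us G =
     \<lparr> pverts = pverts G \<union> set us,
       parcs = parcs G \<union> set (zip (v # us) us) \<union> (set (zip (v # us) us))\<inverse> \<rparr>"

inductive sun_over :: "'a pair_pre_digraph \<Rightarrow> 'a pair_pre_digraph \<Rightarrow> bool"
  for C :: "'a pair_pre_digraph"
where
  cycle: "is_cycle_graph C \<Longrightarrow> sun_over C C"
| attach: "sun_over C G \<Longrightarrow> v \<in> pverts C \<Longrightarrow> us \<noteq> [] \<Longrightarrow> distinct us \<Longrightarrow>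
    set us \<inter> pverts G = {} \<Longrightarrow> sun_over C (attach_path v us G)"

text \<open>
  Any number of paths, of any lengths, may be attached to the same cycle vertex; attaching
  none gives the cycle itself, which is thus a generalized sun graph.
\<close>

definition generalized_sun_graph :: "'a pair_pre_digraph \<Rightarrow> bool" where
  "generalized_sun_graph G \<longleftrightarrow> (\<exists>C. sun_over C G)"

text \<open>
  The graph \<open>C\<^bsub>b,1\<^esub>(n\<^sub>1, \<dots>, n\<^sub>b)\<close>, for \<open>b \<ge> 3\<close>, is
  \<open>pendant_cycle [n\<^sub>1, \<dots>, n\<^sub>b]\<close>. Indices are shifted by one: the cycle vertex
  \<open>v\<^sub>k\<close> is \<open>(k - 1, 0)\<close>, and its pendant vertices are
  \<open>(k - 1, 1), \<dots>, (k - 1, n\<^sub>k)\<close>.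
\<close>

definition pendant_cycle :: "nat list \<Rightarrow> (nat \<times> nat) pair_pre_digraph" where
  "pendant_cycle ns =
     fold (\<lambda>(k, j). attach_path (k, 0) [(k, j)])
       [(k, j). k \<leftarrow> [0..<length ns], j \<leftarrow> [1..<Suc (ns ! k)]]
       (cycle_graph (map (\<lambda>k. (k, 0)) [0..<length ns]))"

lemma adjacency_matrix_wrt_carrier [simp]:
  "adjacency_matrix_wrt xs G \<in> carrier_mat (length xs) (length xs)"
  by (simp add: adjacency_matrix_wrt_def)

lemma char_poly_adjacency_matrix_wrt_unique:
  assumes xs: "distinct xs" and ys: "distinct ys" and eq: "set xs = set ys"
  shows "char_poly (adjacency_matrix_wrt xs G) = char_poly (adjacency_matrix_wrt ys G)"
proof -
  define n where "n = length xs"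
  have n': "length ys = n"
    using xs ys eq n_def by (metis distinct_card)
  define P Q :: "complex mat"
    where "P = mat n n (\<lambda>(i, j). if xs ! i = ys ! j then 1 else 0)"
      and "Q = mat n n (\<lambda>(i, j). if ys ! i = xs ! j then 1 else 0)"
  define A B where "A = adjacency_matrix_wrt xs G" and "B = adjacency_matrix_wrt ys G"
  have dims: "A \<in> carrier_mat n n" "B \<in> carrier_mat n n" "P \<in> carrier_mat n n" "Q \<in> carrier_mat n n"
    using n' by (simp_all add: A_def B_def P_def Q_def n_def carrier_matI adjacency_matrix_wrt_def)
  have "\<exists>f. \<forall>i<n. f i < n \<and> ys ! f i = xs ! i"
  proof -
    have "\<exists>j. i < n \<longrightarrow> j < n \<and> ys ! j = xs ! i" for i
      using eq n' n_def by (metis in_set_conv_nth nth_mem)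
    then show ?thesis by metis
  qed
  then obtain f where f: "\<And>i. i < n \<Longrightarrow> f i < n \<and> ys ! f i = xs ! i" by blast
  have fy: "xs ! i = ys ! j \<longleftrightarrow> j = f i" if "i < n" "j < n" for i j
    using f[OF that(1)] ys n' that nth_eq_iff_index_eq by metis
  have inj: "f i = f j \<longleftrightarrow> i = j" if "i < n" "j < n" for i j
    using f that xs n_def nth_eq_iff_index_eq by metis
  have surj: "\<exists>i<n. f i = j" if "j < n" for j
  proof -
    have "ys ! j \<in> set xs" using eq n' that by auto
    then obtain i where "i < n" "xs ! i = ys ! j"
      using n_def by (metis in_set_conv_nth)
    with fy that show ?thesis by metis
  qed
  have Pf: "P = mat n n (\<lambda>(i, j). if j = f i then 1 else 0)"
    unfolding P_def by (rule cong_mat) (auto simp: fy)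
  have Qf: "Q = mat n n (\<lambda>(i, j). if i = f j then 1 else 0)"
    unfolding Q_def by (rule cong_mat) (auto simp: fy[symmetric])
  have PQ: "P * Q = 1\<^sub>m n"
    unfolding Pf Qf using f
    by (intro eq_matI) (auto simp: scalar_prod_def if_distrib[of "\<lambda>x. x * _"] inj cong: if_cong)
  have QP: "Q * P = 1\<^sub>m n"
    by (rule mat_mult_left_right_inverse[OF dims(3,4) PQ])
  have PB: "(P * B) $$ (i, j) = B $$ (f i, j)" if "i < n" "j < n" for i j
    using that dims(2) f[of i] unfolding Pf
    by (auto simp: scalar_prod_def if_distrib[of "\<lambda>x. x * _"] cong: if_cong)
  have "(P * B * Q) $$ (i, j) = B $$ (f i, f j)" if ij: "i < n" "j < n" for i j
  proof -
    have "(P * B * Q) $$ (i, j) = (\<Sum>k<n. (P * B) $$ (i, k) * Q $$ (k, j))"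
      using ij dims by (subst index_mult_mat) (auto simp: scalar_prod_def lessThan_atLeast0)
    also have "\<dots> = (\<Sum>k<n. if k = f j then B $$ (f i, k) else 0)"
      using ij by (intro sum.cong) (auto simp: PB Qf)
    finally show ?thesis using f[OF ij(2)] by simp
  qed
  moreover have "A $$ (i, j) = B $$ (f i, f j)" if "i < n" "j < n" for i j
    using that f n' by (auto simp: A_def B_def adjacency_matrix_wrt_def n_def)
  ultimately have "A = P * B * Q"
    using dims by (intro eq_matI) auto
  then have "similar_mat A B"
    unfolding similar_mat_def similar_mat_wit_def using dims PQ QP
    by (intro exI[of _ P] exI[of _ Q]) auto
  then show ?thesis
    unfolding A_def B_def by (rule char_poly_similar)
qed

lemma char_poly_adjacency_matrix:
  assumes "distinct xs" and "set xs = pverts G"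
  shows "char_poly (adjacency_matrix G) = char_poly (adjacency_matrix_wrt xs G)"
proof -
  have "distinct (SOME xs. distinct xs \<and> set xs = pverts G) \<and>
      set (SOME xs. distinct xs \<and> set xs = pverts G) = pverts G"
    by (rule someI[of "\<lambda>xs. distinct xs \<and> set xs = pverts G" xs]) (use assms in auto)
  then show ?thesis
    unfolding adjacency_matrix_def
    by (intro char_poly_adjacency_matrix_wrt_unique) (use assms in auto)
qed

lemma eigenvalue_iff_in_graph_spectrum:
  "eigenvalue (adjacency_matrix G) x \<longleftrightarrow> x \<in># graph_spectrum G"
proof -
  obtain n where n: "adjacency_matrix G \<in> carrier_mat n n"
    unfolding adjacency_matrix_def using adjacency_matrix_wrt_carrier by blast
  then have "char_poly (adjacency_matrix G) \<noteq> 0"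
    using degree_monic_char_poly[OF n] by auto
  then show ?thesis
    by (simp add: graph_spectrum_def eigenvalue_root_char_poly[OF n])
qed

lemma pair_graph_cycle_graph:
  assumes "is_cycle_graph C"
  shows "pair_graph C"
proof -
  obtain vs where vs: "distinct vs" "3 \<le> length vs" "C = cycle_graph vs"
    using assms by (auto simp: is_cycle_graph_def)
  have "a \<noteq> b" if ab: "(a, b) \<in> set (zip vs (rotate1 vs))" for a b
  proof -
    obtain i where "i < length (zip vs (rotate1 vs))" "zip vs (rotate1 vs) ! i = (a, b)"
      using ab by (meson in_set_conv_nth)
    then have i: "i < length vs" "a = vs ! i" "b = vs ! (Suc i mod length vs)"
      by (simp_all add: nth_rotate1)
    moreover have "Suc i mod length vs \<noteq> i"
      using i(1) vs(2) by (cases "Suc i = length vs") auto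
    moreover have "Suc i mod length vs < length vs"
      using vs(2) by (intro mod_less_divisor) auto
    ultimately show ?thesis
      using vs(1) by (simp add: nth_eq_iff_index_eq)
  qed
  then have "(a, a) \<notin> set (zip vs (rotate1 vs))" for a
    by blast
  then show ?thesis
    unfolding vs(3) cycle_graph_def
    by unfold_locales
      (auto simp: symmetric_def sym_def dest: set_zip_leftD set_zip_rightD)
qed

lemma pair_graph_attach_path:
  assumes "pair_graph G" "v \<in> pverts G" "distinct us" "set us \<inter> pverts G = {}"
  shows "pair_graph (attach_path v us G)"
proof -
  interpret pair_graph G by fact
  have ne: "a \<noteq> b" if ab: "(a, b) \<in> set (zip (v # us) us)" for a b
  proof -
    have "distinct (v # us)" using assms by auto
    moreover obtain i where "i < length (zip (v # us) us)" "zip (v # us) us ! i = (a, b)"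
      using ab by (meson in_set_conv_nth)
    then have "i < length us" "a = (v # us) ! i" "b = (v # us) ! Suc i"
      by (simp_all del: zip_Cons_Cons)
    ultimately show ?thesis
      by (metis Suc_mono length_Cons less_SucI n_not_Suc_n nth_eq_iff_index_eq)
  qed
  have mem: "a \<in> insert v (set us)" "b \<in> set us" if "(a, b) \<in> set (zip (v # us) us)" for a b
    using set_zip_leftD[OF that] set_zip_rightD[OF that] by auto
  have "symmetric (with_proj G)" by (rule pair_sym_arcs)
  then show ?thesis
    using ne mem assms(2) pair_finite_verts pair_finite_arcs pair_no_loops
    unfolding attach_path_def
    by unfold_locales
      (auto simp: symmetric_def sym_def simp del: zip_Cons_Cons dest: wellformed', blast+)
qed

lemma sun_over_pair_graph:
  "sun_over C G \<Longrightarrow> pair_graph G \<and> is_cycle_graph C \<and> pverts C \<subseteq> pverts G"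
proof (induction rule: sun_over.induct)
  case cycle
  then show ?case by (simp add: pair_graph_cycle_graph)
next
  case (attach G v us)
  then have "pair_graph (attach_path v us G)"
    by (intro pair_graph_attach_path) auto
  with attach show ?case by (auto simp: attach_path_def)
qed

lemma pverts_pendant_cycle:
  "pverts (pendant_cycle ns) = {(k, j). k < length ns \<and> j \<le> ns ! k}"
proof -
  have *: "pverts (fold (\<lambda>(k, j). attach_path (k, 0) [(k, j)]) ps G) = pverts G \<union> set ps"
    for ps and G :: "(nat \<times> nat) pair_pre_digraph"
    by (induction ps arbitrary: G) (auto simp: attach_path_def)
  show ?thesis
    unfolding pendant_cycle_def *
  proof (rule Set.set_eqI)
    fix x :: "nat \<times> nat"
    obtain k j where x: "x = (k, j)" by fastforce
    show "x \<in> pverts (cycle_graph (map (\<lambda>k. (k, 0)) [0..<length ns])) \<union>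
        set [(k, j). k \<leftarrow> [0..<length ns], j \<leftarrow> [1..<Suc (ns ! k)]] \<longleftrightarrow>
      x \<in> {(k, j). k < length ns \<and> j \<le> ns ! k}"
      unfolding x by (cases "j = 0") (auto simp: cycle_graph_def image_iff simp del: upt_Suc)
  qed
qed

lemma parcs_pendant_cycle:
  "parcs (pendant_cycle ns) =
     (let E = {((k, 0), (Suc k mod length ns, 0)) | k. k < length ns} \<union>
              {((k, 0), (k, j)) | k j. k < length ns \<and> 1 \<le> j \<and> j \<le> ns ! k}
      in E \<union> E\<inverse>)"
proof -
  have *: "parcs (fold (\<lambda>(k, j). attach_path (k, 0) [(k, j)]) ps G) =
      parcs G \<union> (\<lambda>(k, j). ((k, 0), (k, j))) ` set ps \<union> ((\<lambda>(k, j). ((k, 0), (k, j))) ` set ps)\<inverse>"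
    for ps and G :: "(nat \<times> nat) pair_pre_digraph"
    by (induction ps arbitrary: G) (auto simp: attach_path_def)
  have c: "set (zip (map (\<lambda>k. (k, 0::nat)) [0..<n]) (rotate1 (map (\<lambda>k. (k, 0::nat)) [0..<n])))
      = {((k, 0), (Suc k mod n, 0)) | k. k < n}" for n
  proof -
    have "set (zip (map (\<lambda>k. (k, 0::nat)) [0..<n]) (rotate1 (map (\<lambda>k. (k, 0::nat)) [0..<n])))
        = (\<lambda>i. ((i, 0), (Suc i mod n, 0))) ` {..<n}"
    proof -
      have "zip (map (\<lambda>k. (k, 0::nat)) [0..<n]) (rotate1 (map (\<lambda>k. (k, 0::nat)) [0..<n])) =
          map (\<lambda>i. ((i, 0), (Suc i mod n, 0))) [0..<n]"
        by (rule nth_equalityI) (auto simp: nth_rotate1)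
      then show ?thesis by (simp only: set_map set_upt lessThan_atLeast0)
    qed
    then show ?thesis by auto
  qed
  show ?thesis
    unfolding pendant_cycle_def * Let_def cycle_graph_def pair_pre_digraph.simps c
    by (auto simp: Suc_le_eq image_iff)
qed

end

theory Submission
  imports Defs
begin

text \<open>
  Eliminating the pendant vertices from \<open>x I - A\<close> by a Schur complement turns the
  characteristic polynomial of \<open>C\<^bsub>b,1\<^esub>(n\<^sub>1, \<dots>, n\<^sub>b)\<close>, up to a power of \<open>x\<close>, into the
  \<open>b \<times> b\<close> determinant of \<open>x\<^sup>2 I - x A(C\<^sub>b) - diag(n\<^sub>1, \<dots>, n\<^sub>b)\<close>. For the graph at hand
  that is a \<open>6 \<times> 6\<close> determinant which splits into linear factors. A cycle in a pendant
  cycle avoids the pendant vertices, as these have degree \<open>1\<close>; so each of its vertices uses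
  both edges of the core cycle there, and it is the core cycle.
\<close>

section \<open>Determinants: a Schur complement and the weighted hexagon\<close>

text \<open>Right multiplication by the block triangular \<open>?N\<close>, of determinant
  \<open>x ^ n\<close>, clears the lower left block. Nothing is divided by \<open>x\<close>, so
  \<open>x = 0\<close> is covered.\<close>

lemma det_four_block_mat_scalar:
  fixes A B C :: "'a :: idom mat"
  assumes A: "A \<in> carrier_mat n n" and B: "B \<in> carrier_mat n m" and C: "C \<in> carrier_mat m n"
  shows "det (four_block_mat A B C (x \<cdot>\<^sub>m 1\<^sub>m m)) * x ^ n = det (x \<cdot>\<^sub>m A - B * C) * x ^ m"
proof -
  let ?M = "four_block_mat A B C (x \<cdot>\<^sub>m 1\<^sub>m m)"
  let ?N = "four_block_mat (x \<cdot>\<^sub>m 1\<^sub>m n) (0\<^sub>m n m) (- C) (1\<^sub>m m)"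
  have BC: "B * C \<in> carrier_mat n n" using B C by simp
  have "det ?M * det ?N = det (?M * ?N)"
    by (rule det_mult[symmetric, of _ "n + m"]) (use A B C in auto)
  also have "?M * ?N = four_block_mat (x \<cdot>\<^sub>m A - B * C) B (0\<^sub>m m n) (x \<cdot>\<^sub>m 1\<^sub>m m)"
  proof -
    have "A * (x \<cdot>\<^sub>m 1\<^sub>m n) + B * - C = x \<cdot>\<^sub>m A - B * C"
      using A B C BC by (auto simp: mult_smult_distrib[of _ n n _ n] add_uminus_minus_mat)
    moreover have "A * 0\<^sub>m n m + B * 1\<^sub>m m = B" using A B by simp
    moreover have "C * (x \<cdot>\<^sub>m 1\<^sub>m n) + x \<cdot>\<^sub>m 1\<^sub>m m * - C = 0\<^sub>m m n"
      using C by (auto simp: mult_smult_distrib[of _ m n _ n] mult_smult_assoc_mat[of _ m m _ n])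
    moreover have "C * 0\<^sub>m n m + x \<cdot>\<^sub>m 1\<^sub>m m * 1\<^sub>m m = x \<cdot>\<^sub>m 1\<^sub>m m" using C by simp
    ultimately show ?thesis
      using A B C by (subst mult_four_block_mat[of _ n n _ m _ m]) auto
  qed
  also have "det \<dots> = det (x \<cdot>\<^sub>m A - B * C) * det (x \<cdot>\<^sub>m 1\<^sub>m m)"
    by (rule det_four_block_mat_lower_left_zero) (use A B C in auto)
  also have "det ?N = det (x \<cdot>\<^sub>m 1\<^sub>m n) * det (1\<^sub>m m)"
    by (rule det_four_block_mat_upper_right_zero) (use C in auto)
  finally show ?thesis by simp
qed

text \<open>Laplace expansion along the first row, with minors again given as explicit lists of rows
  so that the simplifier can iterate it.\<close>

lemma det_mat_of_rows_list_Suc: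
  fixes r :: "'a :: comm_ring_1 list"
  assumes "length r = Suc n" and "length rs = n" and "\<forall>q \<in> set rs. length q = Suc n"
  shows "det (mat_of_rows_list (Suc n) (r # rs)) = (\<Sum>j<Suc n. r ! j * ((- 1) ^ j *
     det (mat_of_rows_list n (map (\<lambda>q. take j q @ drop (Suc j) q) rs))))"
proof -
  have del: "mat_delete (mat_of_rows_list (Suc n) (r # rs)) 0 j =
      mat_of_rows_list n (map (\<lambda>q. take j q @ drop (Suc j) q) rs)" if "j < Suc n" for j
    using assms that
    by (auto simp: mat_delete_def mat_of_rows_list_def nth_append min_def)
  show ?thesis
    using assms del
    by (subst laplace_expansion_row[of _ "Suc n" 0])
      (auto simp: cofactor_def mat_of_rows_list_def)
qed

lemma det_mat_of_rows_list_2: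
  "det (mat_of_rows_list 2 [[a, b], [c, d]]) = a * d - b * (c :: 'a :: comm_ring_1)"
  using det_mat_of_rows_list_Suc[of "[a, b]" 1 "[[c, d]]"]
    det_mat_of_rows_list_Suc[of "[c]" 0 "[]"] det_mat_of_rows_list_Suc[of "[d]" 0 "[]"]
  by (simp add: numeral_2_eq_2 lessThan_Suc mat_of_rows_list_def)

text \<open>The reflection of the hexagon fixing vertices 0 and 3 preserves the weights. Its skew
  part gives the factor \<open>y^2 - x^2\<close> of the determinant below, its symmetric part the
  other factor.\<close>

lemma det_pencil_0_6_6_12_6_6:
  fixes x :: complex
  shows "det (mat 6 6 (\<lambda>(k, l). (if k = l then x\<^sup>2 - of_nat ([0, 6, 6, 12, 6, 6] ! k) else 0) -
      (if l = Suc k mod 6 \<or> k = Suc l mod 6 then x else 0))) =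
    x\<^sup>2 * (x - 2)\<^sup>2 * (x + 2)\<^sup>2 * (x - 3)\<^sup>2 * (x + 3)\<^sup>2 * (x - 4) * (x + 4)"
    (is "det ?M = _")
proof -
  \<comment> \<open>The diagonal stays symbolic during the expansion; its values in \<open>x\<close>
    are inserted only at the end.\<close>
  define rows where "rows w y z =
    [[w, -x, 0, 0, 0, -x],
     [-x, y, -x, 0, 0, 0],
     [0, -x, y, -x, 0, 0],
     [0, 0, -x, z, -x, 0],
     [0, 0, 0, -x, y, -x],
     [-x, 0, 0, 0, -x, y]]" for w y z
  let ?R = "mat_of_rows_list 6 (rows (x\<^sup>2) (x\<^sup>2 - 6) (x\<^sup>2 - 12))"
  have "?M = ?R"
  proof (rule eq_matI)
    fix i j
    assume "i < dim_row ?R" "j < dim_col ?R"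
    then have "i \<in> {0, 1, 2, 3, 4, 5}" "j \<in> {0, 1, 2, 3, 4, 5}"
      by (auto simp: mat_of_rows_list_def rows_def)
    then show "?M $$ (i, j) = ?R $$ (i, j)"
      by (auto simp: mat_of_rows_list_def rows_def)
  qed (simp_all add: mat_of_rows_list_def rows_def)
  moreover have "det (mat_of_rows_list 6 (rows w y z)) =
      (y\<^sup>2 - x\<^sup>2) * ((w * y - 2 * x\<^sup>2) * (y * z - 2 * x\<^sup>2) - w * z * x\<^sup>2)" for w y z
    \<comment> \<open>One size at a time, so that minors with coefficient \<open>0\<close> disappear before being expanded.\<close>
    apply (simp add: rows_def det_mat_of_rows_list_Suc[of _ 5, simplified] lessThan_nat_numeral lessThan_Suc)
    apply (simp add: det_mat_of_rows_list_Suc[of _ 4, simplified] lessThan_nat_numeral lessThan_Suc)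
    apply (simp add: det_mat_of_rows_list_Suc[of _ 3, simplified] lessThan_nat_numeral lessThan_Suc)
    apply (simp add: det_mat_of_rows_list_Suc[of _ 2, simplified] lessThan_nat_numeral lessThan_Suc
        det_mat_of_rows_list_2)
    apply (simp add: algebra_simps power2_eq_square)
    done
  ultimately show ?thesis by (simp only:) (simp add: algebra_simps power2_eq_square)
qed

section \<open>Pendant vertices and cycle subgraphs\<close>

text \<open>With \<open>g = 1\<close> this counts the pendant vertices; with an indicator it
  evaluates the entries of the Schur correction term.\<close>

lemma sum_list_pendant_vertices:
  fixes g :: "nat \<Rightarrow> 'a :: semiring_1"
  shows "(\<Sum>p\<leftarrow>[(k, j). k \<leftarrow> [0..<length ns], j \<leftarrow> [1..<Suc (ns ! k)]]. g (fst p)) = (\<Sum>k<length ns. of_nat (ns ! k) * g k)"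
proof -
  \<comment> \<open>The bound \<open>n\<close> is decoupled from \<open>length ns\<close>, so that
    the induction leaves \<open>ns\<close> fixed.\<close>
  have "(\<Sum>p\<leftarrow>[(k, j). k \<leftarrow> [0..<n], j \<leftarrow> [1..<Suc (ns ! k)]]. g (fst p)) = (\<Sum>k<n. of_nat (ns ! k) * g k)" for n
    by (induction n) (auto simp: o_def sum_list_triv Suc_le_eq distrib_right)
  then show ?thesis .
qed

text \<open>Successor and predecessor differ because the length is at least 3. This is what excludes
  pendant vertices from cycles.\<close>

lemma cycle_graph_neighbours:
  assumes "distinct vs" "3 \<le> length vs" "v \<in> set vs"
  shows "\<exists>a b. a \<noteq> b \<and> (v, a) \<in> parcs (cycle_graph vs) \<and> (v, b) \<in> parcs (cycle_graph vs)"
proof -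
  let ?n = "length vs"
  obtain i where i: "i < ?n" "v = vs ! i" using assms by (metis in_set_conv_nth)
  have zip: "(vs ! j, vs ! (Suc j mod ?n)) \<in> set (zip vs (rotate1 vs))" if "j < ?n" for j
    using that by (auto simp: set_zip nth_rotate1 intro!: exI[of _ j])
  \<comment> \<open>The cyclic predecessor of \<open>i\<close>.\<close>
  define p where "p = (if i = 0 then ?n - 1 else i - 1)"
  have p: "p < ?n" "Suc p mod ?n = i" using i assms(2) by (auto simp: p_def)
  have "Suc i mod ?n \<noteq> p" "Suc i mod ?n < ?n"
    using i assms(2) by (auto simp: p_def mod_Suc)
  then have "vs ! (Suc i mod ?n) \<noteq> vs ! p"
    using assms(1) p(1) by (simp add: nth_eq_iff_index_eq)
  moreover have "(v, vs ! (Suc i mod ?n)) \<in> parcs (cycle_graph vs)" "(v, vs ! p) \<in> parcs (cycle_graph vs)"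
    using zip[OF i(1)] zip[OF p(1)] p(2) i(2) by (auto simp: cycle_graph_def)
  ultimately show ?thesis by blast
qed

lemma distinct_pendant_vertices:
  "distinct [(k, j). k \<leftarrow> [0..<length ns], j \<leftarrow> [1..<Suc (ns ! k)]]"
proof -
  have "distinct [(k, j). k \<leftarrow> [0..<n], j \<leftarrow> [1..<Suc (ns ! k)]]" for n
    by (induction n) (auto simp: distinct_map inj_on_def)
  then show ?thesis .
qed

lemma sun_over_pendant_cycle:
  assumes "3 \<le> length ns"
  shows "sun_over (cycle_graph (map (\<lambda>k. (k, 0)) [0..<length ns])) (pendant_cycle ns)"
proof -
  let ?C = "cycle_graph (map (\<lambda>k. (k, 0 :: nat)) [0..<length ns])"
  have C: "is_cycle_graph ?C"
    unfolding is_cycle_graph_def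
    by (intro exI[of _ "map (\<lambda>k. (k, 0 :: nat)) [0..<length ns]"])
      (use assms in \<open>auto simp: distinct_map inj_on_def\<close>)
  \<comment> \<open>Generalized to any sun \<open>G\<close> over \<open>?C\<close> and any list of
    fresh vertices, as the induction along the fold changes the graph.\<close>
  have fold: "sun_over ?C (fold (\<lambda>(k, j). attach_path (k, 0) [(k, j)]) ps G)"
    if "sun_over ?C G" "distinct ps" "set ps \<inter> pverts G = {}"
      "\<And>k j. (k, j) \<in> set ps \<Longrightarrow> (k, 0) \<in> pverts ?C" for ps G
    using that
  proof (induction ps arbitrary: G)
    case (Cons p ps)
    obtain k j where p: "p = (k, j)" by fastforce
    have "sun_over ?C (attach_path (k, 0) [(k, j)] G)"
      by (rule sun_over.attach) (use Cons.prems p in auto)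
    moreover have "set ps \<inter> pverts (attach_path (k, 0) [(k, j)] G) = {}"
      using Cons.prems p by (auto simp: attach_path_def)
    ultimately show ?case
      using Cons.prems p Cons.IH[of "attach_path (k, 0) [(k, j)] G"] by auto
  qed simp
  then show ?thesis
    unfolding pendant_cycle_def
    by (intro fold sun_over.cycle C distinct_pendant_vertices) (auto simp: cycle_graph_def)
qed

lemma wf_digraph_with_proj:
  assumes "pair_graph G"
  shows "wf_digraph (with_proj G)"
proof -
  interpret pair_graph G by fact
  show ?thesis by (simp add: wf_digraph_wp_iff pair_wf_digraph_axioms)
qed

text \<open>Cycles are compared as labelled subgraphs, so this yields both the uniqueness of the
  cycle and its order.\<close>

lemma cycle_in_pendant_cycle_iff:
  assumes "3 \<le> length ns"
  shows "cycle_in C (pendant_cycle ns) \<longleftrightarrow> C = cycle_graph (map (\<lambda>k. (k, 0)) [0..<length ns])"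
proof
  let ?n = "length ns"
  let ?K = "cycle_graph (map (\<lambda>k. (k, 0 :: nat)) [0..<?n])"
  let ?G = "pendant_cycle ns"
  have Kverts: "pverts ?K = {(k, 0) | k. k < ?n}"
    by (auto simp: cycle_graph_def)
  have lt: "Suc k mod ?n < ?n" for k
    using assms by (intro mod_less_divisor) auto
  have zip: "zip (map (\<lambda>k. (k, 0::nat)) [0..<?n]) (rotate1 (map (\<lambda>k. (k, 0::nat)) [0..<?n])) =
      map (\<lambda>k. ((k, 0), (Suc k mod ?n, 0))) [0..<?n]"
    by (rule nth_equalityI) (auto simp: nth_rotate1 lt)
  have Karcs: "(u, v) \<in> parcs ?K \<longleftrightarrow> (\<exists>k l. u = (k, 0) \<and> v = (l, 0) \<and> k < ?n \<and> l < ?n \<and>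
      (l = Suc k mod ?n \<or> k = Suc l mod ?n))" for u v
    using assms by (auto simp: cycle_graph_def zip image_iff lt)
  have sun: "sun_over ?K ?G" by (rule sun_over_pendant_cycle[OF assms])
  have G: "pair_graph ?G" and K: "is_cycle_graph ?K" "pverts ?K \<subseteq> pverts ?G"
    using sun_over_pair_graph[OF sun] by auto
  have wfG: "wf_digraph (with_proj ?G)"
    by (rule wf_digraph_with_proj[OF G])
  {
    assume "C = ?K"
    moreover have "parcs ?K \<subseteq> parcs ?G"
      by (auto simp: Karcs parcs_pendant_cycle Let_def)
    moreover have "wf_digraph (with_proj ?K)"
      by (rule wf_digraph_with_proj[OF pair_graph_cycle_graph[OF K(1)]])
    ultimately show "cycle_in C ?G"
      using K wfG by (simp add: cycle_in_def subgraph_def compatible_def)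
  }
  assume C: "cycle_in C ?G"
  obtain vs where vs: "distinct vs" "3 \<le> length vs" "C = cycle_graph vs"
    using C by (auto simp: cycle_in_def is_cycle_graph_def)
  have sub: "pverts C \<subseteq> pverts ?G" "parcs C \<subseteq> parcs ?G"
    using C by (auto simp: cycle_in_def subgraph_def)
  interpret C: pair_graph C
    using C by (auto simp: cycle_in_def intro: pair_graph_cycle_graph)
  have sym: "(v, u) \<in> parcs C" if "(u, v) \<in> parcs C" for u v
    using that by (auto simp: vs(3) cycle_graph_def)
  have nb: "\<exists>a b. a \<noteq> b \<and> (v, a) \<in> parcs C \<and> (v, b) \<in> parcs C" if "v \<in> pverts C" for v
    using that unfolding vs(3) by (intro cycle_graph_neighbours[OF vs(1,2)]) (simp add: cycle_graph_def)
  \<comment> \<open>Every arc from a pendant vertex leads to the cycle vertex it hangs from, whereas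
    a vertex of \<open>C\<close> has two distinct neighbours.\<close>
  have core: "snd v = 0" if v: "v \<in> pverts C" for v
  proof (rule ccontr)
    assume "snd v \<noteq> 0"
    then have "a = (fst v, 0)" if "(v, a) \<in> parcs ?G" for a
      using that by (auto simp: parcs_pendant_cycle Let_def)
    then show False using nb[OF v] sub(2) by blast
  qed
  have arcs: "parcs C \<subseteq> parcs ?K"
  proof (intro subrelI)
    fix u v assume uv: "(u, v) \<in> parcs C"
    then have "snd u = 0" "snd v = 0" using core C.wellformed'[OF uv] by auto
    moreover have "(u, v) \<in> parcs ?G" using uv sub(2) by blast
    ultimately show "(u, v) \<in> parcs ?K"
      using assms lt by (auto simp: Karcs parcs_pendant_cycle Let_def)
  qed
  have step: "((k, 0), (Suc k mod ?n, 0)) \<in> parcs C" if k: "(k, 0) \<in> pverts C" for k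
  proof -
    obtain a b where ab: "a \<noteq> b" "((k, 0), a) \<in> parcs C" "((k, 0), b) \<in> parcs C"
      using nb[OF k] by blast
    then have "((k, 0), a) \<in> parcs ?K" "((k, 0), b) \<in> parcs ?K" using arcs by auto
    then obtain l m where lm: "a = (l, 0)" "b = (m, 0)" "l < ?n" "m < ?n"
      "l = Suc k mod ?n \<or> k = Suc l mod ?n" "m = Suc k mod ?n \<or> k = Suc m mod ?n"
      by (auto simp: Karcs)
    \<comment> \<open>Predecessors are unique, so of the two distinct neighbours of \<open>k\<close>
      one must be the successor.\<close>
    have "l = m" if "k = Suc l mod ?n" "k = Suc m mod ?n"
      using that lm(3,4) by (auto simp: mod_Suc split: if_splits)
    with lm ab show ?thesis by auto
  qed
  have closed: "(Suc k mod ?n, 0) \<in> pverts C" if "(k, 0) \<in> pverts C" for k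
    using C.wellformed'[OF step[OF that]] by auto
  have "pverts C \<noteq> {}" using vs by (auto simp: cycle_graph_def)
  then obtain k where k: "(k, 0) \<in> pverts C" using core by (metis ex_in_conv prod.collapse)
  then have kn: "k < ?n" using sub(1) by (auto simp: pverts_pendant_cycle)
  have "((k + i) mod ?n, 0) \<in> pverts C" for i
  proof (induction i)
    case (Suc i)
    then show ?case using closed[of "(k + i) mod ?n"] by (simp add: mod_Suc_eq)
  qed (use k kn in simp)
  note orbit = this
  have all: "(l, 0) \<in> pverts C" if "l < ?n" for l
    \<comment> \<open>Since \<open>k < ?n\<close>, this many steps lead from \<open>k\<close> to
      \<open>?n + l\<close>, that is, to \<open>l\<close> modulo \<open>?n\<close>.\<close>
    using orbit[of "?n - k + l"] that kn by simp
  have "parcs ?K \<subseteq> parcs C"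
    using step[OF all] sym by (auto simp: Karcs)
  moreover have "pverts C = pverts ?K"
    using all core sub(1) by (fastforce simp: Kverts pverts_pendant_cycle)
  ultimately show "C = ?K" using arcs by (simp add: pair_pre_digraph.equality)
qed


section \<open>The characteristic polynomial of a pendant cycle\<close>

text \<open>The Schur complement over the pendant block; powers of \<open>x\<close> stay on both
  sides so that the identity also holds at \<open>x = 0\<close>.\<close>

lemma char_poly_pendant_cycle:
  fixes ns :: "nat list" and x :: complex
  defines "n \<equiv> length ns"
  shows "x ^ n * poly (char_poly (adjacency_matrix (pendant_cycle ns))) x =
    x ^ sum_list ns * det (mat n n (\<lambda>(k, l). (if k = l then x\<^sup>2 - of_nat (ns ! k) else 0) -
      (if l = Suc k mod n \<or> k = Suc l mod n then x else 0)))"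
proof -
  let ?G = "pendant_cycle ns"
  define ps where "ps = [(k, j). k \<leftarrow> [0..<n], j \<leftarrow> [1..<Suc (ns ! k)]]"
  \<comment> \<open>Cycle vertices come first, which gives the adjacency matrix its block
    form.\<close>
  define xs where "xs = map (\<lambda>k. (k, 0)) [0..<n] @ ps"
  define m where "m = length ps"
  define A where "A = adjacency_matrix_wrt xs ?G"
  define C where "C = mat n n (\<lambda>(k, l). if l = Suc k mod n \<or> k = Suc l mod n then 1 else 0 :: complex)"
  define B where "B = mat n m (\<lambda>(k, q). if fst (ps ! q) = k then 1 else 0 :: complex)"
  have set_ps: "set ps = {(k, j). k < n \<and> 1 \<le> j \<and> j \<le> ns ! k}"
    unfolding ps_def by (auto simp del: upt_Suc)
  have ps: "fst (ps ! q) < n" "1 \<le> snd (ps ! q)" "snd (ps ! q) \<le> ns ! fst (ps ! q)"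
    if "q < m" for q
    using that nth_mem[of q ps] by (auto simp: m_def set_ps)
  have "distinct ps"
    unfolding ps_def n_def by (rule distinct_pendant_vertices)
  then have "distinct xs"
    by (auto simp: xs_def distinct_map inj_on_def set_ps)
  moreover have "set xs = pverts ?G"
    by (auto simp: xs_def set_ps pverts_pendant_cycle n_def)
  ultimately have "char_poly (adjacency_matrix ?G) = char_poly A"
    unfolding A_def by (rule char_poly_adjacency_matrix)
  moreover have m: "m = sum_list ns"
    using sum_list_pendant_vertices[of "\<lambda>_. 1 :: nat" ns]
    by (simp add: m_def ps_def n_def sum_list_triv sum_list_sum_nth atLeast0LessThan del: upt_Suc)
  moreover have A: "A \<in> carrier_mat (n + m) (n + m)"
    unfolding A_def carrier_mat_def by (simp add: adjacency_matrix_wrt_def xs_def m_def)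
  \<comment> \<open>The left side is \<open>x I - A\<close>. Pendant vertices are pairwise
    nonadjacent, so the lower right block is scalar.\<close>
  have "- char_matrix A x = four_block_mat (x \<cdot>\<^sub>m 1\<^sub>m n - C) (- B) (- B\<^sup>T) (x \<cdot>\<^sub>m 1\<^sub>m m)"
  proof (rule eq_matI)
    fix i j
    assume "i < dim_row (four_block_mat (x \<cdot>\<^sub>m 1\<^sub>m n - C) (- B) (- B\<^sup>T) (x \<cdot>\<^sub>m 1\<^sub>m m))"
      and "j < dim_col (four_block_mat (x \<cdot>\<^sub>m 1\<^sub>m n - C) (- B) (- B\<^sup>T) (x \<cdot>\<^sub>m 1\<^sub>m m))"
    then have ij: "i < n + m" "j < n + m" by (simp_all add: B_def C_def)
    have xs: "xs ! k = (if k < n then (k, 0) else ps ! (k - n))" if "k < n + m" for k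
      using that by (simp add: xs_def nth_append m_def)
    have offset: "k - n < m" if "\<not> k < n" "k < n + m" for k
      using that by auto
    have "(xs ! i, xs ! j) \<in> parcs ?G \<longleftrightarrow>
       (if i < n then if j < n then j = Suc i mod n \<or> i = Suc j mod n else fst (ps ! (j - n)) = i
        else j < n \<and> fst (ps ! (i - n)) = j)"
      using ij ps[of "i - n"] ps[of "j - n"] offset[of i] offset[of j]
      by (cases "ps ! (i - n)"; cases "ps ! (j - n)")
        (auto simp: xs parcs_pendant_cycle Let_def n_def[symmetric])
    then show "(- char_matrix A x) $$ (i, j) =
        four_block_mat (x \<cdot>\<^sub>m 1\<^sub>m n - C) (- B) (- B\<^sup>T) (x \<cdot>\<^sub>m 1\<^sub>m m) $$ (i, j)"
      using ij A by (auto simp: char_matrix_def B_def C_def A_def adjacency_matrix_wrt_def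
        xs_def[THEN arg_cong[where f = length]] m_def)
  qed (use A in \<open>auto simp: char_matrix_def B_def C_def\<close>)
  then have "poly (char_poly A) x * x ^ n = det (x \<cdot>\<^sub>m (x \<cdot>\<^sub>m 1\<^sub>m n - C) - - B * - B\<^sup>T) * x ^ m"
    unfolding char_poly_matrix[OF A]
    by (simp only:) (rule det_four_block_mat_scalar, auto simp: B_def C_def)
  moreover have "x \<cdot>\<^sub>m (x \<cdot>\<^sub>m 1\<^sub>m n - C) - - B * - B\<^sup>T =
    mat n n (\<lambda>(k, l). (if k = l then x\<^sup>2 - of_nat (ns ! k) else 0) -
      (if l = Suc k mod n \<or> k = Suc l mod n then x else 0))"
  proof -
    \<comment> \<open>Each pendant vertex hangs from a single cycle vertex, so the rows of
      \<open>B\<close> have disjoint supports; row \<open>k\<close> has \<open>ns ! k\<close>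
      ones.\<close>
    have "(- B * - B\<^sup>T) $$ (k, l) = (if k = l then of_nat (ns ! k) else 0)" if "k < n" "l < n" for k l
    proof -
      have "(- B * - B\<^sup>T) $$ (k, l) = (\<Sum>q<m. if fst (ps ! q) = k \<and> k = l then 1 else 0)"
        using that by (auto simp: B_def scalar_prod_def lessThan_atLeast0 intro!: sum.cong)
      also have "\<dots> = (\<Sum>p\<leftarrow>ps. if fst p = k \<and> k = l then 1 else 0)"
        by (simp add: sum_list_sum_nth m_def lessThan_atLeast0)
      also have "\<dots> = (\<Sum>i<n. of_nat (ns ! i) * (if i = k \<and> k = l then 1 else 0))"
        unfolding ps_def n_def by (rule sum_list_pendant_vertices)
      also have "\<dots> = (if k = l then of_nat (ns ! k) else 0)"
        using that by (simp add: if_distrib[of "\<lambda>y. _ * y"] cong: if_cong)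
      finally show ?thesis .
    qed
    then show ?thesis
      by (intro eq_matI) (auto simp: B_def C_def power2_eq_square algebra_simps)
  qed
  ultimately show ?thesis by (simp add: mult.commute)
qed

section \<open>Spectrum and cycle of the graph on 42 vertices\<close>

theorem proposition3p2:
  fixes G :: "(nat \<times> nat) pair_pre_digraph"
  assumes G: "G = pendant_cycle [0, 6, 6, 12, 6, 6]"
  shows "card (pverts G) = 42 \<and>
    graph_spectrum G =
      replicate_mset 32 0 + replicate_mset 2 2 + replicate_mset 2 (-2) +
      replicate_mset 2 3 + replicate_mset 2 (-3) + {#4#} + {#-4#} \<and>
    integral_graph G \<and> generalized_sun_graph G \<and> \<not> is_cycle_graph G \<and>
    (\<exists>!C. cycle_in C G) \<and> (\<forall>C. cycle_in C G \<longrightarrow> card (pverts C) = 6) \<and>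
    \<not> (\<forall>(H :: (nat \<times> nat) pair_pre_digraph) C.
        generalized_sun_graph H \<and> \<not> is_cycle_graph H \<and> integral_graph H \<and> cycle_in C H
        \<longrightarrow> 4 dvd card (pverts C))"
proof -
  let ?ns = "[0, 6, 6, 12, 6, 6] :: nat list"
  let ?K = "cycle_graph (map (\<lambda>k. (k, 0 :: nat)) [0..<length ?ns])"
  have "pverts G = (SIGMA k:{..<6}. {..?ns ! k})"
    by (auto simp: G pverts_pendant_cycle)
  then have card: "card (pverts G) = 42"
    by (simp add: lessThan_nat_numeral lessThan_Suc)
  \<comment> \<open>The part of the characteristic polynomial with nonzero roots.\<close>
  define p :: "complex poly" where "p = [:-2, 1:] ^ 2 * [:2, 1:] ^ 2 * [:-3, 1:] ^ 2 * [:3, 1:] ^ 2 *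
    [:-4, 1:] * [:4, 1:]"
  have len: "length ?ns = 6" and sum: "sum_list ?ns = 36" by simp_all
  \<comment> \<open>The exponents 6 and 36 count cycle and pendant vertices, and 2 comes from the
    determinant; hence the multiplicity 36 + 2 - 6 = 32 of the eigenvalue 0.\<close>
  have "poly ([:0, 1:] ^ 6 * char_poly (adjacency_matrix G)) x = poly ([:0, 1:] ^ 36 * ([:0, 1:] ^ 2 * p)) x" for x
    using char_poly_pendant_cycle[of x ?ns] unfolding len sum G[symmetric] det_pencil_0_6_6_12_6_6
    by (simp only: p_def poly_mult poly_power) (simp add: algebra_simps)
  then have "[:0, 1:] ^ 6 * char_poly (adjacency_matrix G) = [:0, 1:] ^ 6 * ([:0, 1:] ^ 32 * p)"
    by (simp add: poly_eq_poly_eq_iff[symmetric] fun_eq_iff)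
  then have "char_poly (adjacency_matrix G) = [:0, 1:] ^ 32 * p"
    by (rule mult_left_cancel[THEN iffD1, rotated]) simp
  then have spec: "graph_spectrum G = replicate_mset 32 0 + replicate_mset 2 2 + replicate_mset 2 (-2) +
      replicate_mset 2 3 + replicate_mset 2 (-3) + {#4#} + {#-4#}"
    by (simp add: graph_spectrum_def p_def proots_mult proots_power del: mult_pCons_left mult_pCons_right)
  have sun: "sun_over ?K G"
    unfolding G by (rule sun_over_pendant_cycle) simp
  then have pg: "pair_graph G" and "generalized_sun_graph G"
    by (auto simp: sun_over_pair_graph generalized_sun_graph_def)
  moreover have "integral_graph G"
    unfolding integral_graph_def eigenvalue_iff_in_graph_spectrum spec
    using pg by (auto simp: in_replicate_mset)
  moreover have cyc: "cycle_in C G \<longleftrightarrow> C = ?K" for C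
    unfolding G by (rule cycle_in_pendant_cycle_iff) simp
  moreover have cardK: "card (pverts ?K) = 6"
    by (simp add: cycle_graph_def)
  \<comment> \<open>Otherwise \<open>G\<close> would be a cycle in itself, hence equal to
    \<open>?K\<close>, but 42 is not 6.\<close>
  moreover have "\<not> is_cycle_graph G"
  proof
    assume "is_cycle_graph G"
    moreover have "wf_digraph (with_proj G)"
      by (rule wf_digraph_with_proj[OF pg])
    ultimately have "cycle_in G G"
      by (simp add: cycle_in_def subgraph_def compatible_def)
    with card cardK cyc show False by simp
  qed
  \<comment> \<open>With this, \<open>G\<close> and \<open>?K\<close> refute the divisibility
    claim.\<close>
  moreover have "\<not> 4 dvd (6 :: nat)" by simp
  ultimately show ?thesis using card spec by metis
qed

end
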